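(* Let $Y$ be a convergence-approach space. The following are equivalent: (a) $Y$ is strongly regular; (b) for every convergence-approach space $X$ and every $f\in Y^{X}$, $$m_{\vee}(f)\leq\bigwedge_{\mathcal{F}\in\mathbb{F}(Y^{X})}\lambda_{[X,Y]}(\mathcal{F})(f);$$ (c) for every topological space $X$ (viewed as a convergence-approach space) and every $f\in Y^{X}$, $$m_{\vee}(f)\leq\bigwedge_{\mathcal{F}\in\mathbb{F}(Y^{X})}\lambda_{[X,Y]}(\mathcal{F})(f).$$
   Context: Filters are proper. $\mathbb{F}X$ is the set of filters on $X$, ordered by inclusion; $\mathbb{U}X$ is the set of ultrafilters; $\mathcal{F}\wedge\mathcal{G}=\mathcal{F}\cap\mathcal{G}$; $\mathcal{A}^{\uparrow}=\{B\subseteq X:\exists A\in\mathcal{A},\ A\subseteq B\}$; $\{x\}^{\uparrow}$ is the principal ultrafilter at $x$. A filter base is identified with the filter it generates. $f[\mathcal{F}]=\{f(F):F\in\mathcal{F}\}^{\uparrow}$. On $[0,\infty]$, $\vee$ is maximum. A convergence-approach space is a pair $(X,\lambda_X)$ with $\lambda_X:\mathbb{F}X\to[0,\infty]^{X}$ (ordered pointwise) such that $\lambda_X(\mathcal{F}\wedge\mathcal{G})=\lambda_X(\mathcal{F})\vee\lambda_X(\mathcal{G})$ for all $\mathcal{F},\mathcal{G}\in\mathbb{F}X$ and $\lambda_X(\{x\}^{\uparrow})(x)=0$ for all $x\in X$. A topological space is viewed as a convergence-approach space via $\lambda_X(\mathcal{F})(x)=0$ if $\mathcal{F}$ contains the neighborhood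 filter of $x$, and $\infty$ otherwise. For $A\subseteq X$ and $\epsilon\ge0$, $A^{(\epsilon)}=\{x\in X:\exists\,\mathcal{U}\in\mathbb{U}X,\ A\in\mathcal{U},\ \lambda_X(\mathcal{U})(x)\le\epsilon\}$, and $\mathcal{F}^{(\epsilon)}=\{F^{(\epsilon)}:F\in\mathcal{F}\}$. A convergence-approach space is strongly regular if $\lambda_X(\mathcal{F}^{(\epsilon)})\le\lambda_X(\mathcal{F})\vee\epsilon$ for all $\mathcal{F}\in\mathbb{F}X$, $\epsilon\in[0,\infty]$. For $f\in Y^{X}$ (the set of all functions $X\to Y$) and $\mathcal{F}\in\mathbb{F}(Y^{X})$, $$\lambda_{[X,Y]}(\mathcal{F})(f)=\inf\{\alpha\in[0,\infty]:\forall\mathcal{G}\in\mathbb{F}X,\ \lambda_{Y}(\langle\mathcal{G},\mathcal{F}\rangle)\circ f\le\lambda_{X}(\mathcal{G})\vee\alpha\},$$ where $\langle\mathcal{G},\mathcal{F}\rangle=\{\langle G,F\rangle:G\in\mathcal{G},F\in\mathcal{F}\}^{\uparrow}$ and $\langle G,F\rangle=\{h(x):h\in F,x\in G\}$; and $$m_{\vee}(f)=\inf\{\alpha\in[0,\infty]:\forall\mathcal{G}\in\mathbb{F}X,\ \lambda_{Y}(f[\mathcal{G}])\circ f\le\lambda_{X}(\mathcal{G})\vee\alpha\}.$$ *)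

theory Defs
  imports "HOL-Analysis.Abstract_Limits" "HOL-Library.Extended_Nonnegative_Real" "HOL-Library.FuncSet"
begin

text \<open>
  A filter on a set \<open>X\<close> is a proper library filter containing \<open>X\<close>. The library order on filters is
  reverse inclusion: \<open>F \<le> G\<close> means that \<open>F\<close> is finer than \<open>G\<close>. Hence the intersection of two
  filters is \<open>sup F G\<close>, and \<open>principal A\<close> is the family of all supersets of \<open>A\<close>.
  The image filter of \<open>F\<close> under \<open>f\<close> is \<open>filtermap f F\<close>.
\<close>

definition filters_on :: "'a set \<Rightarrow> 'a filter set" where
  "filters_on X = {F. F \<noteq> bot \<and> F \<le> principal X}"

definition ultrafilters_on :: "'a set \<Rightarrow> 'a filter set" where
  "ultrafilters_on X = {U \<in> filters_on X. \<forall>G \<in> filters_on X. G \<le> U \<longrightarrow> G = U}"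

text \<open>
  Spaces have an explicit carrier. Only the values \<open>lam F x\<close> with \<open>F \<in> filters_on X\<close> and
  \<open>x \<in> X\<close> are meaningful.
\<close>

definition cap_space :: "'a set \<Rightarrow> ('a filter \<Rightarrow> 'a \<Rightarrow> ennreal) \<Rightarrow> bool" where
  "cap_space X lam \<longleftrightarrow>
     (\<forall>F \<in> filters_on X. \<forall>G \<in> filters_on X. \<forall>x \<in> X. lam (sup F G) x = max (lam F x) (lam G x)) \<and>
     (\<forall>x \<in> X. lam (principal {x}) x = 0)"

definition top_lim :: "'a topology \<Rightarrow> 'a filter \<Rightarrow> 'a \<Rightarrow> ennreal" where
  "top_lim T F x = (if F \<le> nhdsin T x then 0 else \<infinity>)"

definition cap_closure ::
    "'a set \<Rightarrow> ('a filter \<Rightarrow> 'a \<Rightarrow> ennreal) \<Rightarrow> ennreal \<Rightarrow> 'a set \<Rightarrow> 'a set" where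
  "cap_closure X lam \<epsilon> A =
     {x \<in> X. \<exists>U \<in> ultrafilters_on X. eventually (\<lambda>y. y \<in> A) U \<and> lam U x \<le> \<epsilon>}"

definition closure_filter ::
    "'a set \<Rightarrow> ('a filter \<Rightarrow> 'a \<Rightarrow> ennreal) \<Rightarrow> ennreal \<Rightarrow> 'a filter \<Rightarrow> 'a filter" where
  "closure_filter X lam \<epsilon> F =
     (INF A \<in> {A. A \<subseteq> X \<and> eventually (\<lambda>y. y \<in> A) F}. principal (cap_closure X lam \<epsilon> A))"

definition strongly_regular :: "'a set \<Rightarrow> ('a filter \<Rightarrow> 'a \<Rightarrow> ennreal) \<Rightarrow> bool" where
  "strongly_regular X lam \<longleftrightarrow>
     (\<forall>F \<in> filters_on X. \<forall>\<epsilon>. \<forall>x \<in> X. lam (closure_filter X lam \<epsilon> F) x \<le> max (lam F x) \<epsilon>)"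

definition eval_filter :: "'a filter \<Rightarrow> ('a \<Rightarrow> 'b) filter \<Rightarrow> 'b filter" where
  "eval_filter G F = filtermap (\<lambda>(x, h). h x) (G \<times>\<^sub>F F)"

text \<open>The set of all functions from \<open>X\<close> to \<open>Y\<close> is the set \<open>X \<rightarrow>\<^sub>E Y\<close> of extensional functions.\<close>

definition fun_lim ::
    "'a set \<Rightarrow> ('a filter \<Rightarrow> 'a \<Rightarrow> ennreal) \<Rightarrow> ('b filter \<Rightarrow> 'b \<Rightarrow> ennreal) \<Rightarrow>
     ('a \<Rightarrow> 'b) filter \<Rightarrow> ('a \<Rightarrow> 'b) \<Rightarrow> ennreal" where
  "fun_lim X lamX lamY F f =
     Inf {\<alpha>. \<forall>G \<in> filters_on X. \<forall>x \<in> X. lamY (eval_filter G F) (f x) \<le> max (lamX G x) \<alpha>}"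

definition m_sup ::
    "'a set \<Rightarrow> ('a filter \<Rightarrow> 'a \<Rightarrow> ennreal) \<Rightarrow> ('b filter \<Rightarrow> 'b \<Rightarrow> ennreal) \<Rightarrow>
     ('a \<Rightarrow> 'b) \<Rightarrow> ennreal" where
  "m_sup X lamX lamY f =
     Inf {\<alpha>. \<forall>G \<in> filters_on X. \<forall>x \<in> X. lamY (filtermap f G) (f x) \<le> max (lamX G x) \<alpha>}"

text \<open>Membership in the two generated filters, in terms of the bases generating them.\<close>

lemma eventually_eval_filter:
  "eventually P (eval_filter G F) \<longleftrightarrow>
     (\<exists>A H. eventually (\<lambda>x. x \<in> A) G \<and> eventually (\<lambda>h. h \<in> H) F \<and>
        {h x |h x. h \<in> H \<and> x \<in> A} \<subseteq> {y. P y})"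
proof
  assume "eventually P (eval_filter G F)"
  then obtain Q R where "eventually Q G" "eventually R F" "\<And>x h. Q x \<Longrightarrow> R h \<Longrightarrow> P (h x)"
    by (auto simp: eval_filter_def eventually_filtermap eventually_prod_filter)
  then show "\<exists>A H. eventually (\<lambda>x. x \<in> A) G \<and> eventually (\<lambda>h. h \<in> H) F \<and>
      {h x |h x. h \<in> H \<and> x \<in> A} \<subseteq> {y. P y}"
    by (intro exI[of _ "Collect Q"] exI[of _ "Collect R"]) auto
next
  assume "\<exists>A H. eventually (\<lambda>x. x \<in> A) G \<and> eventually (\<lambda>h. h \<in> H) F \<and>
      {h x |h x. h \<in> H \<and> x \<in> A} \<subseteq> {y. P y}"
  then show "eventually P (eval_filter G F)"
    unfolding eval_filter_def eventually_filtermap eventually_prod_filter by fastforce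
qed

lemma eventually_closure_filter:
  assumes "F \<in> filters_on X"
  shows "eventually P (closure_filter X lam \<epsilon> F) \<longleftrightarrow>
    (\<exists>A. A \<subseteq> X \<and> eventually (\<lambda>y. y \<in> A) F \<and> cap_closure X lam \<epsilon> A \<subseteq> {y. P y})"
proof -
  have mono: "cap_closure X lam \<epsilon> (A \<inter> B) \<subseteq> cap_closure X lam \<epsilon> A \<inter> cap_closure X lam \<epsilon> B" for A B
    by (auto simp: cap_closure_def eventually_conj_iff)
  have X: "eventually (\<lambda>y. y \<in> X) F"
    using assms by (simp add: filters_on_def le_principal)
  have "eventually P (closure_filter X lam \<epsilon> F) \<longleftrightarrow>
      (\<exists>A \<in> {A. A \<subseteq> X \<and> eventually (\<lambda>y. y \<in> A) F}. eventually P (principal (cap_closure X lam \<epsilon> A)))"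
    unfolding closure_filter_def
  proof (rule eventually_INF_base)
    show "{A. A \<subseteq> X \<and> eventually (\<lambda>y. y \<in> A) F} \<noteq> {}"
      using X by blast
    fix A B
    assume "A \<in> {A. A \<subseteq> X \<and> eventually (\<lambda>y. y \<in> A) F}" "B \<in> {A. A \<subseteq> X \<and> eventually (\<lambda>y. y \<in> A) F}"
    then show "\<exists>C \<in> {A. A \<subseteq> X \<and> eventually (\<lambda>y. y \<in> A) F}.
        principal (cap_closure X lam \<epsilon> C)
          \<le> inf (principal (cap_closure X lam \<epsilon> A)) (principal (cap_closure X lam \<epsilon> B))"
      using mono[of A B] by (intro bexI[of _ "A \<inter> B"]) (auto simp: eventually_conj_iff)
  qed
  then show ?thesis
    by (auto simp: eventually_principal)
qed

lemma cap_space_top_lim: "cap_space (topspace T) (top_lim T)"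
proof -
  have "principal {x} \<le> nhdsin T x" if "x \<in> topspace T" for x
    using that by (auto simp: nhdsin_def intro!: INF_greatest)
  then show ?thesis
    by (auto simp: cap_space_def top_lim_def)
qed

end

theory Submission
  imports Defs
begin

text \<open>
  Suppose first that \<open>Y\<close> is strongly regular, and let \<open>\<alpha>\<close> be a bound for
  \<open>\<F>\<close> at \<open>f\<close>, that is, one of the numbers over which the infimum defining
  \<open>fun_lim\<close> is taken. Applying this bound to the point filters \<open>principal {x}\<close>, whose own limit
  value at \<open>x\<close> is \<open>0\<close>, shows that every value \<open>f x\<close> is an \<open>\<alpha>\<close>-limit of the filter obtained by
  evaluating \<open>\<F>\<close> at \<open>x\<close>. Hence \<open>f[\<G>]\<close> is finer than the \<open>\<alpha>\<close>-closure of
  \<open>\<langle>\<G>, \<F>\<rangle>\<close> (lemma \<open>filtermap_le_closure_eval_filter\<close>), and strong regularity carries the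
  bound for \<open>\<langle>\<G>, \<F>\<rangle>\<close> over to \<open>f[\<G>]\<close>. So \<open>\<alpha>\<close> also takes part in the infimum defining \<open>m_sup\<close>.

  Conversely, one topological test space suffices for each instance of strong regularity. Given
  a filter \<open>\<F>\<close> on \<open>Y\<close>, a point \<open>x0\<close> and a number \<open>\<epsilon>\<close>, take as isolated
  points all pairs \<open>(y, A)\<close> with \<open>y\<close> in the \<open>\<epsilon>\<close>-closure of \<open>A\<close>, and add one point \<open>w\<close>, whose
  neighbourhoods contain, for some \<open>A\<close> in \<open>\<F>\<close>, all pairs \<open>(y, B)\<close> with
  \<open>B \<subseteq> A\<close>. Let \<open>f (y, A) = y\<close> and \<open>f w = x0\<close>. Each pair comes with an ultrafilter on \<open>A\<close> that
  converges to \<open>y\<close> up to \<open>\<epsilon>\<close>. The product of these ultrafilters, taken on the functions \<open>h\<close>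
  with \<open>h (y, A) \<in> A\<close>, converges to \<open>f\<close> up to the maximum of \<open>\<epsilon>\<close> and \<open>lamY \<F> x0\<close>: at an
  isolated point it evaluates to the chosen ultrafilter, and near \<open>w\<close> its values lie in the sets
  of \<open>\<F>\<close> (lemma \<open>fun_lim_product_filter_le\<close>). On the other hand the image under
  \<open>f\<close> of the neighbourhood filter of \<open>w\<close> is coarser than the \<open>\<epsilon>\<close>-closure of \<open>\<F>\<close>
  (lemma \<open>closure_filter_le_filtermap_nhdsin\<close>). The assumed inequality for \<open>f\<close> therefore bounds
  the limit of that closure at \<open>x0\<close>.
\<close>

section \<open>Filters\<close>

text \<open>
  Zorn's lemma: a chain of proper filters has a proper infimum, because the nonempty finite subsets of
  the chain have their least element as infimum.
\<close>

lemma ex_ultrafilter_le: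
  assumes "F \<in> filters_on X"
  obtains U where "U \<in> ultrafilters_on X" "U \<le> F"
proof -
  let ?A = "{G. G \<noteq> bot \<and> G \<le> F}"
  have "\<exists>U\<in>?A. \<forall>G\<in>?A. G \<le> U \<longrightarrow> G = U"
  proof (rule predicate_Zorn)
    show "partial_order_on ?A (relation_of (\<lambda>G H. H \<le> G) ?A)"
      by (rule partial_order_on_relation_ofI) auto
    fix C assume C: "C \<in> Chains (relation_of (\<lambda>G H. H \<le> G) ?A)"
    then have CA: "C \<subseteq> ?A" and tot: "\<And>G H. G \<in> C \<Longrightarrow> H \<in> C \<Longrightarrow> G \<le> H \<or> H \<le> G"
      by (auto simp: Chains_def relation_of_def)
    show "\<exists>u\<in>?A. \<forall>G\<in>C. u \<le> G"
    proof (cases "C = {}")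
      case True
      then show ?thesis using assms by (auto simp: filters_on_def)
    next
      case False
      have fin: "D = {} \<or> Inf D \<in> D" if "finite D" "D \<subseteq> C" for D
        using that
      proof (induction rule: finite_induct)
        case (insert G D)
        then have "D = {} \<or> G \<le> Inf D \<or> Inf D \<le> G"
          using tot[of G "Inf D"] by auto
        with insert show ?case
          by (auto simp: inf_absorb1 inf_absorb2)
      qed simp
      have "Inf C \<noteq> bot"
      proof (rule Inf_filter_not_bot)
        fix D assume "D \<subseteq> C" "finite D"
        obtain G where "G \<in> C" using False by blast
        with CA have "G \<noteq> bot" by auto
        then have "(top :: 'a filter) \<noteq> bot"
          by (metis top_greatest bot_unique)
        with fin[of D] CA \<open>D \<subseteq> C\<close> \<open>finite D\<close> show "Inf D \<noteq> bot"
          by (cases "D = {}") auto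
      qed
      moreover have "Inf C \<le> F"
        using False CA by (auto intro: Inf_lower2)
      ultimately show ?thesis
        by (auto intro!: bexI[of _ "Inf C"] Inf_lower)
    qed
  qed
  then obtain U where "U \<noteq> bot" "U \<le> F" and "\<And>G. G \<noteq> bot \<Longrightarrow> G \<le> F \<Longrightarrow> G \<le> U \<Longrightarrow> G = U"
    by blast
  with assms have "U \<in> ultrafilters_on X"
    by (auto simp: ultrafilters_on_def filters_on_def intro: order_trans)
  with \<open>U \<le> F\<close> show thesis by (rule that[rotated])
qed

text \<open>
  Monotonicity is the part of the axiom on intersections that is used most: if \<open>F \<le> G\<close>
  then \<open>sup F G = G\<close>.
\<close>

lemma cap_space_mono:
  assumes "cap_space X lam" "G \<in> filters_on X" "F \<noteq> bot" "F \<le> G" "x \<in> X"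
  shows "lam F x \<le> lam G x"
proof -
  have "F \<in> filters_on X"
    using assms by (auto simp: filters_on_def)
  then have "lam (sup F G) x = max (lam F x) (lam G x)"
    using assms by (auto simp: cap_space_def)
  then show ?thesis
    using assms(4) by (simp add: sup_absorb2 max_def split: if_splits)
qed

lemma eval_filter_mono: "G \<le> G' \<Longrightarrow> F \<le> F' \<Longrightarrow> eval_filter G F \<le> eval_filter G' F'"
  unfolding eval_filter_def by (intro filtermap_mono prod_filter_mono)

lemma eval_filter_neq_bot: "G \<noteq> bot \<Longrightarrow> F \<noteq> bot \<Longrightarrow> eval_filter G F \<noteq> bot"
  by (simp add: eval_filter_def filtermap_bot_iff prod_filter_eq_bot)

lemma eval_filter_in_filters_on:
  assumes "G \<in> filters_on X" "F \<in> filters_on (X \<rightarrow>\<^sub>E Y)"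
  shows "eval_filter G F \<in> filters_on Y"
proof -
  have "eval_filter G F \<le> eval_filter (principal X) (principal (X \<rightarrow>\<^sub>E Y))"
    using assms by (intro eval_filter_mono) (auto simp: filters_on_def)
  also have "\<dots> \<le> principal Y"
    by (auto simp: eval_filter_def principal_prod_principal)
  finally show ?thesis
    using assms by (simp add: filters_on_def eval_filter_neq_bot)
qed

lemma filtermap_in_filters_on:
  assumes "G \<in> filters_on X" "f \<in> X \<rightarrow> Y"
  shows "filtermap f G \<in> filters_on Y"
  using assms
  by (auto simp: filters_on_def filtermap_bot_iff le_principal eventually_filtermap
      elim!: eventually_mono)

lemma cap_closure_subset: "cap_closure X lam \<epsilon> A \<subseteq> X"
  by (auto simp: cap_closure_def)

text \<open>
  Membership in a closure can be witnessed by any proper filter: passing to a finer ultrafilter only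
  decreases the limit value.
\<close>

lemma cap_closureI:
  assumes "cap_space X lam" "x \<in> X" "F \<in> filters_on X" "eventually (\<lambda>y. y \<in> A) F" "lam F x \<le> \<epsilon>"
  shows "x \<in> cap_closure X lam \<epsilon> A"
proof -
  obtain U where U: "U \<in> ultrafilters_on X" "U \<le> F"
    using ex_ultrafilter_le[OF assms(3)] .
  have "U \<noteq> bot" using U by (simp add: ultrafilters_on_def filters_on_def)
  then have "lam U x \<le> \<epsilon>"
    using cap_space_mono[OF assms(1,3) _ U(2) assms(2)] assms(5) by (meson order_trans)
  moreover have "eventually (\<lambda>y. y \<in> A) U"
    using U(2) assms(4) by (rule filter_leD)
  ultimately show ?thesis
    using U(1) assms(2) by (auto simp: cap_closure_def)
qed

lemma subset_cap_closure:
  assumes "cap_space X lam" "A \<subseteq> X"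
  shows "A \<subseteq> cap_closure X lam \<epsilon> A"
proof
  fix x assume "x \<in> A"
  with assms show "x \<in> cap_closure X lam \<epsilon> A"
    by (intro cap_closureI[where F = "principal {x}"])
       (auto simp: filters_on_def cap_space_def eventually_principal principal_eq_bot_iff)
qed

lemma closure_filter_in_filters_on:
  assumes "cap_space X lam" "F \<in> filters_on X"
  shows "closure_filter X lam \<epsilon> F \<in> filters_on X"
proof -
  have "\<not> eventually (\<lambda>_. False) (closure_filter X lam \<epsilon> F)"
  proof
    assume "eventually (\<lambda>_. False) (closure_filter X lam \<epsilon> F)"
    then obtain A where "A \<subseteq> X" "eventually (\<lambda>y. y \<in> A) F" "cap_closure X lam \<epsilon> A = {}"
      by (auto simp: eventually_closure_filter[OF assms(2)])
    moreover from this have "A = {}"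
      using subset_cap_closure[OF assms(1), of A \<epsilon>] by simp
    ultimately have "eventually (\<lambda>_. False) F"
      by simp
    with assms(2) show False
      by (simp add: filters_on_def eventually_False)
  qed
  moreover have "eventually (\<lambda>y. y \<in> X) (closure_filter X lam \<epsilon> F)"
    using assms(2) cap_closure_subset[of X lam \<epsilon> X]
    by (auto simp: eventually_closure_filter[OF assms(2)] filters_on_def le_principal
        intro!: exI[of _ X])
  ultimately show ?thesis
    by (auto simp: filters_on_def le_principal eventually_False)
qed

section \<open>Strong regularity gives the inequality\<close>

text \<open>
  The bound \<open>\<alpha>\<close> at the point filters \<open>principal {x}\<close> is what matters here. Evaluating \<open>F\<close> at \<open>x\<close>
  gives a filter that lives on every set of values \<open>{h x |h x. h \<in> H \<and> x \<in> A}\<close> with \<open>x \<in> A\<close> and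
  has \<open>f x\<close> as a limit up to \<open>\<alpha>\<close>. So \<open>f\<close> maps \<open>A\<close> into the \<open>\<alpha>\<close>-closure of that set.
\<close>

lemma filtermap_le_closure_eval_filter:
  assumes Y: "cap_space Y lamY" and X: "cap_space X lamX"
    and f: "f \<in> X \<rightarrow>\<^sub>E Y" and F: "F \<in> filters_on (X \<rightarrow>\<^sub>E Y)" and G: "G \<in> filters_on X"
    and \<alpha>: "\<And>G x. G \<in> filters_on X \<Longrightarrow> x \<in> X \<Longrightarrow> lamY (eval_filter G F) (f x) \<le> max (lamX G x) \<alpha>"
  shows "filtermap f G \<le> closure_filter Y lamY \<alpha> (eval_filter G F)"
proof (rule filter_leI)
  fix P assume "eventually P (closure_filter Y lamY \<alpha> (eval_filter G F))"
  then obtain C where ev: "eventually (\<lambda>y. y \<in> C) (eval_filter G F)"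
    and C: "cap_closure Y lamY \<alpha> C \<subseteq> {y. P y}"
    by (auto simp: eventually_closure_filter[OF eval_filter_in_filters_on[OF G F]])
  from ev obtain A H where A: "eventually (\<lambda>x. x \<in> A) G" and H: "eventually (\<lambda>h. h \<in> H) F"
    and AH: "{h x |h x. h \<in> H \<and> x \<in> A} \<subseteq> C"
    unfolding eventually_eval_filter by auto
  have "P (f x)" if "x \<in> A" "x \<in> X" for x
  proof -
    have x: "principal {x} \<in> filters_on X"
      using that by (auto simp: filters_on_def principal_eq_bot_iff)
    have "f x \<in> cap_closure Y lamY \<alpha> C"
    proof (rule cap_closureI[OF Y _ eval_filter_in_filters_on[OF x F]])
      show "f x \<in> Y" using f that by auto
      show "eventually (\<lambda>y. y \<in> C) (eval_filter (principal {x}) F)"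
        unfolding eventually_eval_filter
        using that AH H by (intro exI[of _ "{x}"] exI[of _ H]) (auto simp: eventually_principal)
      show "lamY (eval_filter (principal {x}) F) (f x) \<le> \<alpha>"
        using \<alpha>[OF x that(2)] X that by (simp add: cap_space_def)
    qed
    with C show ?thesis by auto
  qed
  moreover have "eventually (\<lambda>x. x \<in> X) G"
    using G by (simp add: filters_on_def le_principal)
  ultimately show "eventually P (filtermap f G)"
    using A unfolding eventually_filtermap by (auto elim: eventually_elim2)
qed

text \<open>
  Every \<open>\<alpha>\<close> in the set defining \<open>fun_lim\<close> also lies in the set defining \<open>m_sup\<close>. The
  regularity axiom is used with \<open>\<epsilon> = \<alpha>\<close>, so that the extra \<open>\<epsilon>\<close> in it is absorbed.
\<close>

lemma strongly_regular_imp_m_sup_le: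
  assumes Y: "cap_space Y lamY" and reg: "strongly_regular Y lamY" and X: "cap_space X lamX"
    and f: "f \<in> X \<rightarrow>\<^sub>E Y" and F: "F \<in> filters_on (X \<rightarrow>\<^sub>E Y)"
  shows "m_sup X lamX lamY f \<le> fun_lim X lamX lamY F f"
  unfolding m_sup_def fun_lim_def
proof (rule Inf_superset_mono, clarify)
  fix \<alpha> G x
  assume \<alpha>: "\<forall>G\<in>filters_on X. \<forall>x\<in>X. lamY (eval_filter G F) (f x) \<le> max (lamX G x) \<alpha>"
    and G: "G \<in> filters_on X" and x: "x \<in> X"
  let ?E = "eval_filter G F"
  have E: "?E \<in> filters_on Y" by (rule eval_filter_in_filters_on[OF G F])
  have fx: "f x \<in> Y" using f x by auto
  have "filtermap f G \<noteq> bot" using G by (simp add: filters_on_def filtermap_bot_iff)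
  then have "lamY (filtermap f G) (f x) \<le> lamY (closure_filter Y lamY \<alpha> ?E) (f x)"
    using filtermap_le_closure_eval_filter[OF Y X f F G] \<alpha>
    by (intro cap_space_mono[OF Y closure_filter_in_filters_on[OF Y E] _ _ fx]) auto
  also have "\<dots> \<le> max (lamY ?E (f x)) \<alpha>"
    using reg E fx by (simp add: strongly_regular_def)
  also have "\<dots> \<le> max (lamX G x) \<alpha>"
    using \<alpha> G x by auto
  finally show "lamY (filtermap f G) (f x) \<le> max (lamX G x) \<alpha>" .
qed

section \<open>Product filters\<close>

text \<open>
  The filter generated by the sections of the product \<open>Pi\<^sub>E J C\<close> whose values at finitely many
  indices \<open>i\<close> lie in prescribed members of \<open>U i\<close>. Restricting all coordinates to \<open>C\<close> at once,
  and not only finitely many, gives uniform control of the values near a point that is not isolated.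
\<close>

definition product_filter :: "'i set \<Rightarrow> ('i \<Rightarrow> 'y set) \<Rightarrow> ('i \<Rightarrow> 'y filter) \<Rightarrow> ('i \<Rightarrow> 'y) filter" where
  "product_filter J C U = inf (INF i\<in>J. filtercomap (\<lambda>h. h i) (U i)) (principal (Pi\<^sub>E J C))"

lemma product_filter_neq_bot:
  assumes U: "\<And>i. i \<in> J \<Longrightarrow> U i \<in> filters_on (C i)"
  shows "product_filter J C U \<noteq> bot"
proof
  assume "product_filter J C U = bot"
  then have "eventually (\<lambda>h. h \<notin> Pi\<^sub>E J C) (INF i\<in>J. filtercomap (\<lambda>h. h i) (U i))"
    by (simp add: product_filter_def trivial_limit_def eventually_inf_principal)
  then obtain K where "K \<subseteq> J" "finite K"
    "eventually (\<lambda>h. h \<notin> Pi\<^sub>E J C) (INF i\<in>K. filtercomap (\<lambda>h. h i) (U i))"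
    by (subst (asm) eventually_INF) auto
  then obtain Q where Q: "\<And>i. i \<in> K \<Longrightarrow> eventually (Q i) (filtercomap (\<lambda>h. h i) (U i))"
    and empty: "\<And>h. (\<And>i. i \<in> K \<Longrightarrow> Q i h) \<Longrightarrow> h \<notin> Pi\<^sub>E J C"
    by (simp add: eventually_INF_finite) blast
  have "\<exists>y\<in>C i. i \<in> K \<longrightarrow> (\<forall>h. h i = y \<longrightarrow> Q i h)" if i: "i \<in> J" for i
  proof -
    have "\<exists>R. eventually R (U i) \<and> (i \<in> K \<longrightarrow> (\<forall>h. R (h i) \<longrightarrow> Q i h))"
      using Q[of i] by (cases "i \<in> K") (auto simp: eventually_filtercomap intro: exI[of _ "\<lambda>_. True"])
    then obtain R where R: "eventually R (U i)" "i \<in> K \<longrightarrow> (\<forall>h. R (h i) \<longrightarrow> Q i h)"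
      by blast
    have "eventually (\<lambda>y. y \<in> C i \<and> R y) (U i)"
      using U[OF i] R(1) by (simp add: filters_on_def le_principal eventually_conj)
    moreover have "U i \<noteq> bot"
      using U[OF i] by (simp add: filters_on_def)
    ultimately obtain y where "y \<in> C i" "R y"
      using eventually_happens' by blast
    with R(2) show ?thesis by (intro bexI[of _ y]) auto
  qed
  \<comment> \<open>A section through the sets \<open>C i\<close> that meets the finitely many conditions given by \<open>K\<close>\<close>
  then obtain g where g: "\<And>i. i \<in> J \<Longrightarrow> g i \<in> C i"
    and gQ: "\<And>i h. i \<in> J \<Longrightarrow> i \<in> K \<Longrightarrow> h i = g i \<Longrightarrow> Q i h"
    by metis
  have "restrict g J \<notin> Pi\<^sub>E J C"
    using \<open>K \<subseteq> J\<close> by (intro empty gQ) auto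
  with g show False by auto
qed

lemma eval_product_filter_le:
  assumes "i \<in> J" "G \<le> principal {i}"
  shows "eval_filter G (product_filter J C U) \<le> U i"
proof -
  have "product_filter J C U \<le> filtercomap (\<lambda>h. h i) (U i)"
    unfolding product_filter_def using assms(1) by (intro le_infI1 INF_lower)
  with assms(2) have "eval_filter G (product_filter J C U)
      \<le> eval_filter (principal {i}) (filtercomap (\<lambda>h. h i) (U i))"
    by (rule eval_filter_mono)
  also have "\<dots> \<le> U i"
  proof (rule filter_leI)
    fix P assume "eventually P (U i)"
    then have "eventually (\<lambda>h. h i \<in> {y. P y}) (filtercomap (\<lambda>h. h i) (U i))"
      by (auto simp: eventually_filtercomap)
    then show "eventually P (eval_filter (principal {i}) (filtercomap (\<lambda>h. h i) (U i)))"
      unfolding eventually_eval_filter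
      by (intro exI[of _ "{i}"] exI[of _ "{h. P (h i)}"]) (auto simp: eventually_principal)
  qed
  finally show ?thesis .
qed

section \<open>The test space\<close>

text \<open>
  The points of \<open>I\<close> are isolated, and \<open>i \<in> I\<close> is close to \<open>w\<close> when its label \<open>B i\<close> is contained in
  a small set of \<open>F\<close>. Working with an abstract labelled index set keeps the construction
  independent of how pairs of points and sets are coded in the type of the space.
\<close>

definition test_topology :: "'i \<Rightarrow> 'i set \<Rightarrow> ('i \<Rightarrow> 'y set) \<Rightarrow> 'y filter \<Rightarrow> 'i topology" where
  "test_topology w I B F = topology (\<lambda>V. V \<subseteq> insert w I \<and>
     (w \<in> V \<longrightarrow> (\<exists>A. eventually (\<lambda>y. y \<in> A) F \<and> {i \<in> I. B i \<subseteq> A} \<subseteq> V)))"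

lemma openin_test_topology:
  "openin (test_topology w I B F) V \<longleftrightarrow> V \<subseteq> insert w I \<and>
     (w \<in> V \<longrightarrow> (\<exists>A. eventually (\<lambda>y. y \<in> A) F \<and> {i \<in> I. B i \<subseteq> A} \<subseteq> V))"
proof -
  let ?P = "\<lambda>V. V \<subseteq> insert w I \<and>
     (w \<in> V \<longrightarrow> (\<exists>A. eventually (\<lambda>y. y \<in> A) F \<and> {i \<in> I. B i \<subseteq> A} \<subseteq> V))"
  have "istopology ?P"
    unfolding istopology_def
  proof (intro conjI allI impI)
    fix V W assume VW: "?P V" "?P W"
    then show "V \<inter> W \<subseteq> insert w I" by auto
    assume "w \<in> V \<inter> W"
    with VW obtain A A' where "eventually (\<lambda>y. y \<in> A) F" "{i \<in> I. B i \<subseteq> A} \<subseteq> V"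
      "eventually (\<lambda>y. y \<in> A') F" "{i \<in> I. B i \<subseteq> A'} \<subseteq> W"
      by auto
    then show "\<exists>A. eventually (\<lambda>y. y \<in> A) F \<and> {i \<in> I. B i \<subseteq> A} \<subseteq> V \<inter> W"
      by (intro exI[of _ "A \<inter> A'"]) (auto simp: eventually_conj_iff)
  next
    fix \<V> assume \<V>: "\<forall>V\<in>\<V>. ?P V"
    then show "\<Union>\<V> \<subseteq> insert w I" by auto
    assume "w \<in> \<Union>\<V>"
    then obtain V where "V \<in> \<V>" "w \<in> V" by auto
    with \<V> obtain A where "eventually (\<lambda>y. y \<in> A) F" "{i \<in> I. B i \<subseteq> A} \<subseteq> V"
      by meson
    with \<open>V \<in> \<V>\<close> show "\<exists>A. eventually (\<lambda>y. y \<in> A) F \<and> {i \<in> I. B i \<subseteq> A} \<subseteq> \<Union>\<V>"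
      by auto
  qed
  then show ?thesis
    by (simp add: test_topology_def topology_inverse')
qed

lemma topspace_test_topology [simp]: "topspace (test_topology w I B F) = insert w I"
proof (rule antisym)
  show "topspace (test_topology w I B F) \<subseteq> insert w I"
    using openin_topspace[of "test_topology w I B F"] unfolding openin_test_topology by blast
  have "openin (test_topology w I B F) (insert w I)"
    by (auto simp: openin_test_topology intro: exI[of _ UNIV])
  then show "insert w I \<subseteq> topspace (test_topology w I B F)"
    by (rule openin_subset)
qed

lemma nhdsin_test_topology_isolated:
  assumes "i \<in> I" "i \<noteq> w"
  shows "nhdsin (test_topology w I B F) i \<le> principal {i}"
proof -
  have "openin (test_topology w I B F) {i}"
    using assms by (auto simp: openin_test_topology)
  then show ?thesis
    using assms(1) by (auto simp: le_principal eventually_nhdsin)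
qed

lemma eventually_nhdsin_test_topology:
  "eventually P (nhdsin (test_topology w I B F) w) \<longleftrightarrow>
     P w \<and> (\<exists>A. eventually (\<lambda>y. y \<in> A) F \<and> (\<forall>i\<in>I. B i \<subseteq> A \<longrightarrow> P i))"
proof
  assume "eventually P (nhdsin (test_topology w I B F) w)"
  then show "P w \<and> (\<exists>A. eventually (\<lambda>y. y \<in> A) F \<and> (\<forall>i\<in>I. B i \<subseteq> A \<longrightarrow> P i))"
    unfolding eventually_nhdsin openin_test_topology by auto blast
next
  assume "P w \<and> (\<exists>A. eventually (\<lambda>y. y \<in> A) F \<and> (\<forall>i\<in>I. B i \<subseteq> A \<longrightarrow> P i))"
  then show "eventually P (nhdsin (test_topology w I B F) w)"
    unfolding eventually_nhdsin openin_test_topology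
    by (intro disjI2 exI[of _ "{i \<in> insert w I. P i}"] conjI) auto
qed

text \<open>
  The product filter converges to \<open>f\<close> as well as the two kinds of points permit. At an isolated
  point \<open>i\<close> evaluation gives a filter finer than \<open>U i\<close>. At \<open>w\<close>, a section takes
  the value \<open>f w\<close> in \<open>w\<close> itself and values inside a given set \<open>A\<close> of \<open>F\<close> at all points labelled by
  subsets of \<open>A\<close>, so that the evaluation is finer than \<open>sup F (principal {f w})\<close>. The second part
  of this supremum costs nothing, as the point filter has limit value \<open>0\<close>.
\<close>

lemma fun_lim_product_filter_le:
  assumes Y: "cap_space Y lamY" and F: "F \<in> filters_on Y"
    and w: "w \<notin> I" "f w \<in> Y" "C w = {f w}" "U w = principal {f w}"
    and I: "\<And>i. i \<in> I \<Longrightarrow> f i \<in> Y" "\<And>i. i \<in> I \<Longrightarrow> C i \<subseteq> Y"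
      "\<And>i. i \<in> I \<Longrightarrow> U i \<in> filters_on (C i)" "\<And>i. i \<in> I \<Longrightarrow> lamY (U i) (f i) \<le> \<epsilon>"
  shows "product_filter (insert w I) C U \<in> filters_on (insert w I \<rightarrow>\<^sub>E Y)" (is "?H \<in> _")
    and "fun_lim (insert w I) (top_lim (test_topology w I C F)) lamY (product_filter (insert w I) C U) f
      \<le> max (lamY F (f w)) \<epsilon>"
proof -
  let ?T = "test_topology w I C F"
  have H: "?H \<noteq> bot"
  proof (rule product_filter_neq_bot)
    have "principal {f w} \<noteq> bot" by (simp add: principal_eq_bot_iff)
    then show "U i \<in> filters_on (C i)" if "i \<in> insert w I" for i
      using that I(3) by (cases "i = w") (simp_all add: w(3,4) filters_on_def)
  qed
  have le: "?H \<le> principal (Pi\<^sub>E (insert w I) C)"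
    by (simp add: product_filter_def)
  also have "\<dots> \<le> principal (insert w I \<rightarrow>\<^sub>E Y)"
    using w I(2) by (auto intro!: PiE_mono simp del: PiE_eq_empty_iff)
  finally show "?H \<in> filters_on (insert w I \<rightarrow>\<^sub>E Y)"
    using H by (simp add: filters_on_def)
  have "lamY (eval_filter G ?H) (f x) \<le> max (top_lim ?T G x) (max (lamY F (f w)) \<epsilon>)"
    if G: "G \<in> filters_on (insert w I)" and x: "x \<in> insert w I" for G x
  proof (cases "G \<le> nhdsin ?T x")
    case False
    then show ?thesis by (simp add: top_lim_def)
  next
    case True
    have nb: "eval_filter G ?H \<noteq> bot"
      using G H by (intro eval_filter_neq_bot) (auto simp: filters_on_def)
    have "lamY (eval_filter G ?H) (f x) \<le> max (lamY F (f w)) \<epsilon>"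
    proof (cases "x = w")
      case False
      then have xI: "x \<in> I" using x by auto
      have "eval_filter G ?H \<le> U x"
        using True nhdsin_test_topology_isolated[OF xI False]
        by (intro eval_product_filter_le[OF x]) (rule order_trans)
      moreover have "U x \<in> filters_on Y"
        using I(2,3)[OF xI] by (auto simp: filters_on_def intro: order_trans)
      ultimately have "lamY (eval_filter G ?H) (f x) \<le> lamY (U x) (f x)"
        using Y nb I(1)[OF xI] by (intro cap_space_mono)
      with I(4)[OF xI] show ?thesis by (auto simp: le_max_iff_disj)
    next
      case [simp]: True
      have "eval_filter G ?H \<le> sup F (principal {f w})"
      proof (rule filter_leI)
        fix P assume "eventually P (sup F (principal {f w}))"
        then have P: "eventually P F" "P (f w)"
          by (auto simp: eventually_sup eventually_principal)
        have "eventually (\<lambda>i. i = w \<or> i \<in> I \<and> C i \<subseteq> {y. P y}) (nhdsin ?T w)"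
          using P(1) by (auto simp: eventually_nhdsin_test_topology intro!: exI[of _ "{y. P y}"])
        with \<open>G \<le> nhdsin ?T x\<close> have "eventually (\<lambda>i. i \<in> {i. i = w \<or> i \<in> I \<and> C i \<subseteq> {y. P y}}) G"
          by (auto dest: filter_leD)
        moreover have "eventually (\<lambda>h. h \<in> Pi\<^sub>E (insert w I) C) ?H"
          using le by (simp add: le_principal)
        moreover have "{h i |h i. h \<in> Pi\<^sub>E (insert w I) C \<and> i \<in> {i. i = w \<or> i \<in> I \<and> C i \<subseteq> {y. P y}}}
            \<subseteq> {y. P y}"
          using P(2) w(3) by (fastforce simp: PiE_iff)
        ultimately show "eventually P (eval_filter G ?H)"
          unfolding eventually_eval_filter by blast
      qed
      moreover have fw: "principal {f w} \<in> filters_on Y"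
        using w(2) by (auto simp: filters_on_def principal_eq_bot_iff)
      then have "sup F (principal {f w}) \<in> filters_on Y"
        using F by (auto simp: filters_on_def)
      ultimately have "lamY (eval_filter G ?H) (f w) \<le> lamY (sup F (principal {f w})) (f w)"
        using Y nb w(2) by (intro cap_space_mono)
      also have "\<dots> = lamY F (f w)"
        using Y F fw w(2) by (simp add: cap_space_def)
      finally show ?thesis by (simp add: le_max_iff_disj)
    qed
    then show ?thesis by (simp add: le_max_iff_disj)
  qed
  then show "fun_lim (insert w I) (top_lim ?T) lamY ?H f \<le> max (lamY F (f w)) \<epsilon>"
    unfolding fun_lim_def by (intro Inf_lower) auto
qed

text \<open>
  Among the labels contained in \<open>A\<close> is \<open>A\<close> itself, and the points with that label are mapped onto
  the whole closure of \<open>A\<close>.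
\<close>

lemma closure_filter_le_filtermap_nhdsin:
  assumes Y: "cap_space Y lamY" and F: "F \<in> filters_on Y" and w: "f w \<in> Y"
    and I: "\<And>A y. A \<subseteq> Y \<Longrightarrow> eventually (\<lambda>z. z \<in> A) F \<Longrightarrow> y \<in> cap_closure Y lamY \<epsilon> A \<Longrightarrow>
      \<exists>i\<in>I. C i = A \<and> f i = y"
  shows "closure_filter Y lamY \<epsilon> F \<le> filtermap f (nhdsin (test_topology w I C F) w)"
proof (rule filter_leI)
  fix P assume "eventually P (filtermap f (nhdsin (test_topology w I C F) w))"
  then obtain A where A: "eventually (\<lambda>y. y \<in> A) F" "\<And>i. i \<in> I \<Longrightarrow> C i \<subseteq> A \<Longrightarrow> P (f i)"
    by (auto simp: eventually_filtermap eventually_nhdsin_test_topology)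
  have AY: "eventually (\<lambda>y. y \<in> A \<inter> Y) F"
    using A(1) F by (simp add: filters_on_def le_principal eventually_conj)
  have "P y" if "y \<in> cap_closure Y lamY \<epsilon> (A \<inter> Y)" for y
    using I[OF _ AY that] A(2) by fastforce
  then show "eventually P (closure_filter Y lamY \<epsilon> F)"
    unfolding eventually_closure_filter[OF F] using AY by (intro exI[of _ "A \<inter> Y"]) auto
qed

text \<open>
  On a convergent filter a topological limit operator takes the value \<open>0\<close>, so every
  competitor in the infimum is an upper bound by itself.
\<close>

lemma m_sup_top_lim_bound:
  assumes "G \<in> filters_on (topspace T)" "x \<in> topspace T" "G \<le> nhdsin T x"
  shows "lamY (filtermap f G) (f x) \<le> m_sup (topspace T) (top_lim T) lamY f"
  unfolding m_sup_def
proof (rule Inf_greatest, clarify)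
  fix \<alpha> assume "\<forall>G\<in>filters_on (topspace T). \<forall>x\<in>topspace T.
    lamY (filtermap f G) (f x) \<le> max (top_lim T G x) \<alpha>"
  with assms have "lamY (filtermap f G) (f x) \<le> max (top_lim T G x) \<alpha>" by blast
  with assms(3) show "lamY (filtermap f G) (f x) \<le> \<alpha>" by (simp add: top_lim_def)
qed

text \<open>
  The injection \<open>e\<close> codes the test space: \<open>e None\<close> is the point \<open>w\<close>, and \<open>e (Some (y, A))\<close> is the
  isolated point for a pair with \<open>y\<close> in the closure of \<open>A\<close>.
\<close>

lemma strongly_regularI_topological:
  fixes Y :: "'y set" and e :: "('y \<times> 'y set) option \<Rightarrow> 'x"
  assumes Y: "cap_space Y lamY" and e: "inj e"
    and ineq: "\<And>(T :: 'x topology) f H. f \<in> topspace T \<rightarrow>\<^sub>E Y \<Longrightarrow> H \<in> filters_on (topspace T \<rightarrow>\<^sub>E Y) \<Longrightarrow>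
      m_sup (topspace T) (top_lim T) lamY f \<le> fun_lim (topspace T) (top_lim T) lamY H f"
  shows "strongly_regular Y lamY"
  unfolding strongly_regular_def
proof (intro ballI allI)
  fix F \<epsilon> x0 assume F: "F \<in> filters_on Y" and x0: "x0 \<in> Y"
  define w where "w = e None"
  define I where "I = (\<lambda>p. e (Some p)) ` {(y, A). A \<subseteq> Y \<and> y \<in> cap_closure Y lamY \<epsilon> A}"
  define f where "f = restrict (\<lambda>i. case inv e i of None \<Rightarrow> x0 | Some (y, A) \<Rightarrow> y) (insert w I)"
  define C where "C = (\<lambda>i. case inv e i of None \<Rightarrow> {x0} | Some (y, A) \<Rightarrow> A)"
  let ?T = "test_topology w I C F"
  have w: "w \<notin> I" "f w = x0" "C w = {x0}"
    using e by (auto simp: w_def I_def f_def C_def inj_eq)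
  have I: "C i \<subseteq> Y" "f i \<in> cap_closure Y lamY \<epsilon> (C i)" if "i \<in> I" for i
    using that e by (auto simp: I_def f_def C_def)
  have I_surj: "\<exists>i\<in>I. C i = A \<and> f i = y" if "A \<subseteq> Y" "y \<in> cap_closure Y lamY \<epsilon> A" for A y
    using that e by (intro bexI[of _ "e (Some (y, A))"]) (auto simp: I_def f_def C_def)
  have fY: "f i \<in> Y" if "i \<in> insert w I" for i
    using that w x0 I(2) cap_closure_subset by (metis insert_iff subsetD)
  have f: "f \<in> insert w I \<rightarrow>\<^sub>E Y"
    using fY by (auto simp: f_def)
  \<comment> \<open>The ultrafilter witnessing \<open>f i\<close> in the closure of \<open>C i\<close>, regarded as a filter on \<open>C i\<close>\<close>
  have "\<exists>U. U \<in> filters_on (C i) \<and> lamY U (f i) \<le> \<epsilon>" if "i \<in> I" for i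
    using I(2)[OF that]
    by (auto simp: cap_closure_def ultrafilters_on_def filters_on_def le_principal)
  then obtain U0 where U0: "\<And>i. i \<in> I \<Longrightarrow> U0 i \<in> filters_on (C i) \<and> lamY (U0 i) (f i) \<le> \<epsilon>"
    by metis
  define U where "U = U0(w := principal {x0})"
  let ?H = "product_filter (insert w I) C U"
  have U: "U w = principal {f w}" "\<And>i. i \<in> I \<Longrightarrow> U i \<in> filters_on (C i)"
      "\<And>i. i \<in> I \<Longrightarrow> lamY (U i) (f i) \<le> \<epsilon>"
    using U0 w by (auto simp: U_def)
  have Cw: "C w = {f w}" using w by simp
  note H = fun_lim_product_filter_le[where lamY = lamY and C = C and U = U and f = f and \<epsilon> = \<epsilon>,
      OF Y F w(1) fY[OF insertI1] Cw U(1) fY[OF insertI2] I(1) U(2,3)]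
  let ?N = "nhdsin ?T w"
  have "\<not> eventually (\<lambda>_. False) ?N"
    by (simp add: eventually_nhdsin_test_topology)
  moreover have "eventually (\<lambda>i. i \<in> insert w I) ?N"
    by (auto simp: eventually_nhdsin_test_topology intro: exI[of _ UNIV])
  ultimately have N: "?N \<in> filters_on (insert w I)"
    by (auto simp: filters_on_def le_principal eventually_False)
  have "lamY (closure_filter Y lamY \<epsilon> F) x0 \<le> lamY (filtermap f ?N) x0"
  proof (rule cap_space_mono[OF Y _ _ _ x0])
    show "filtermap f ?N \<in> filters_on Y"
      using N fY by (intro filtermap_in_filters_on) auto
    show "closure_filter Y lamY \<epsilon> F \<noteq> bot"
      using closure_filter_in_filters_on[OF Y F] by (simp add: filters_on_def)
    show "closure_filter Y lamY \<epsilon> F \<le> filtermap f ?N"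
      using I_surj fY by (intro closure_filter_le_filtermap_nhdsin[OF Y F]) auto
  qed
  also have "\<dots> \<le> m_sup (insert w I) (top_lim ?T) lamY f"
    using m_sup_top_lim_bound[of ?N ?T w lamY f] N w by simp
  also have "\<dots> \<le> fun_lim (insert w I) (top_lim ?T) lamY ?H f"
    using ineq[of f ?T ?H] f H(1) by simp
  also have "\<dots> \<le> max (lamY F x0) \<epsilon>"
    using H(2) w by simp
  finally show "lamY (closure_filter Y lamY \<epsilon> F) x0 \<le> max (lamY F x0) \<epsilon>" .
qed

section \<open>The equivalence\<close>

(* The free type variable 'x is the universe of points of the domain spaces X, so (a) --> (b) --> (c)
   is claimed for domains over every type. Only the way back to (a) needs enough domain spaces,
   whence the size condition on 'x there; it is satisfied e.g. by 'x = ('y * 'y set) option. *)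

theorem corollary5:
  fixes Y :: "'y set" and lamY :: "'y filter \<Rightarrow> 'y \<Rightarrow> ennreal"
  assumes "cap_space Y lamY"
  defines "a \<equiv> strongly_regular Y lamY"
    and "b \<equiv> (\<forall>(X :: 'x set) lamX. cap_space X lamX \<longrightarrow>
           (\<forall>f \<in> X \<rightarrow>\<^sub>E Y.
              m_sup X lamX lamY f \<le> (INF F \<in> filters_on (X \<rightarrow>\<^sub>E Y). fun_lim X lamX lamY F f)))"
    and "c \<equiv> (\<forall>T :: 'x topology.
           (\<forall>f \<in> topspace T \<rightarrow>\<^sub>E Y.
              m_sup (topspace T) (top_lim T) lamY f
                \<le> (INF F \<in> filters_on (topspace T \<rightarrow>\<^sub>E Y). fun_lim (topspace T) (top_lim T) lamY F f)))"
  shows "(a \<longrightarrow> b) \<and> (b \<longrightarrow> c) \<and>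
    ((\<exists>e :: ('y \<times> 'y set) option \<Rightarrow> 'x. inj e) \<longrightarrow> (a \<longleftrightarrow> b) \<and> (a \<longleftrightarrow> c))"
proof -
  have ab: b if a
    using that assms(1) unfolding a_def b_def
    by (auto intro!: INF_greatest strongly_regular_imp_m_sup_le)
  have bc: c if b
    using that cap_space_top_lim unfolding b_def c_def by blast
  have ca: a if c "inj e" for e :: "('y \<times> 'y set) option \<Rightarrow> 'x"
    unfolding a_def
    by (rule strongly_regularI_topological[OF assms(1) that(2)])
       (use that(1) in \<open>auto simp: c_def le_INF_iff\<close>)
  show ?thesis
    using ab bc ca by blast
qed

end
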